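(* For all integers $l\ge k\ge 2$, $r(k,l)=k+l-1$.
   Context: For a graph whose edges are coloured red and blue, a red (resp. blue) $t$-connected matching is a connected component of the spanning subgraph formed by the red (resp. blue) edges whose maximum matching has size at least $t$. For positive integers $k,l$, $r(k,l)$ denotes the smallest integer $n$ such that every red-blue colouring of the edges of $K_{n,n}$ contains a red $k$-connected matching or a blue $l$-connected matching. *)

theory Defs
  imports Main
begin

text \<open>A graph is given by a vertex set and a set of two-element edges.\<close>

definition components :: "'a set \<Rightarrow> 'a set set \<Rightarrow> 'a set set" where
  "components V E = V // {(u, v). u \<in> V \<and> v \<in> V \<and> (u, v) \<in> {(x, y). {x, y} \<in> E}\<^sup>*}"

definition is_matching :: "'a set set \<Rightarrow> 'a set set \<Rightarrow> bool" where
  "is_matching E M \<longleftrightarrow> M \<subseteq> E \<and> (\<forall>e\<in>M. \<forall>f\<in>M. e \<noteq> f \<longrightarrow> e \<inter> f = {})"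

text \<open>The maximum is meaningful for finite \<open>E\<close> only; here graphs are always finite.\<close>

definition matching_number :: "'a set set \<Rightarrow> nat" where
  "matching_number E = Max (card ` {M. is_matching E M})"

text \<open>The component with vertex set \<open>C\<close> has edge set \<open>{e \<in> E. e \<subseteq> C}\<close>.\<close>

definition connected_matching :: "nat \<Rightarrow> 'a set \<Rightarrow> 'a set set \<Rightarrow> 'a set \<Rightarrow> bool" where
  "connected_matching t V E C \<longleftrightarrow>
     C \<in> components V E \<and> t \<le> matching_number {e \<in> E. e \<subseteq> C}"

definition Knn_verts :: "nat \<Rightarrow> (nat + nat) set" where
  "Knn_verts n = {..<n} <+> {..<n}"

definition Knn_edges :: "nat \<Rightarrow> (nat + nat) set set" where
  "Knn_edges n = {{Inl i, Inr j} | i j. i < n \<and> j < n}"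

datatype colour = Red | Blue

text \<open>Colourings are total functions on vertex sets, of which only the values on edges matter.
  Each colour class is a spanning subgraph: it keeps all vertices.\<close>

definition colour_class :: "nat \<Rightarrow> ((nat + nat) set \<Rightarrow> colour) \<Rightarrow> colour \<Rightarrow> (nat + nat) set set" where
  "colour_class n c a = {e \<in> Knn_edges n. c e = a}"

definition forces :: "nat \<Rightarrow> nat \<Rightarrow> nat \<Rightarrow> bool" where
  "forces n k l \<longleftrightarrow> (\<forall>c.
     (\<exists>C. connected_matching k (Knn_verts n) (colour_class n c Red) C) \<or>
     (\<exists>C. connected_matching l (Knn_verts n) (colour_class n c Blue) C))"

definition r :: "nat \<Rightarrow> nat \<Rightarrow> nat" where
  "r k l = (LEAST n. forces n k l)"

end

theory Submission
  imports Defs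
begin

text \<open>
  Lower bound: colour an edge red iff its left end is among the first \<open>k - 1\<close> left vertices; then
  \<open>k - 1\<close> vertices meet all red edges and at most \<open>l - 1\<close> vertices meet all blue ones.

  Upper bound, \<open>n = k + l - 1\<close>: suppose first that all edges of one colour lie in a single component.
  If its matching number is below the target \<open>t\<close>, Koenig's theorem gives a vertex cover of size less
  than \<open>t\<close>; deleting it leaves a complete bipartite graph in the other colour, with sides large enough
  for the other target. Suppose now that neither colour has this property, and let \<open>X\<^sub>1 \<union> Y\<^sub>1\<close> be a
  red component containing an edge, with complement \<open>X\<^sub>2 \<union> Y\<^sub>2\<close>. Then \<open>X\<^sub>1 \<times> Y\<^sub>2\<close> and \<open>X\<^sub>2 \<times> Y\<^sub>1\<close> are
  blue, and a further blue edge would join them, so \<open>X\<^sub>1 \<times> Y\<^sub>1\<close> and \<open>X\<^sub>2 \<times> Y\<^sub>2\<close> are red. One of these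
  four complete bipartite graphs is large enough.
\<close>

section \<open>Koenig's theorem\<close>

text \<open>Bipartite graphs are relations here, so a matching is a subset on which
  \<open>fst\<close> and \<open>snd\<close> are both injective.\<close>

definition covers :: "('a \<times> 'b) set \<Rightarrow> 'a set \<Rightarrow> 'b set \<Rightarrow> bool" where
  "covers E A B \<longleftrightarrow> (\<forall>(x, y)\<in>E. x \<in> A \<or> y \<in> B)"

lemma covers_converse: "covers (E\<inverse>) B A \<longleftrightarrow> covers E A B"
  by (auto simp: covers_def)

text \<open>Two edges at one left vertex would give two covers with fewer than \<open>t\<close>
  vertices, each missing just one of these edges. Uncrossing them yields two covers of
  \<open>E\<close> of total size below \<open>2 * t\<close>, so one of them is too small.\<close>

lemma critical_inj_on_fst:
  assumes cover: "\<And>A B. finite A \<Longrightarrow> finite B \<Longrightarrow> covers E A B \<Longrightarrow> t \<le> card A + card B"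
    and crit: "\<And>e. e \<in> E \<Longrightarrow>
      \<exists>A B. finite A \<and> finite B \<and> covers (E - {e}) A B \<and> card A + card B < t"
  shows "inj_on fst E"
proof (rule inj_onI, rule ccontr)
  fix e f assume ef: "e \<in> E" "f \<in> E" "fst e = fst f" "e \<noteq> f"
  then obtain x y z where xyz: "e = (x, y)" "f = (x, z)" "y \<noteq> z"
    by (cases e, cases f) auto
  obtain A B where AB: "finite A" "finite B" "covers (E - {e}) A B" "card A + card B < t"
    using crit[OF ef(1)] by blast
  obtain C D where CD: "finite C" "finite D" "covers (E - {f}) C D" "card C + card D < t"
    using crit[OF ef(2)] by blast
  \<comment> \<open>A cover of \<open>E - {e}\<close> that contains an end of \<open>e\<close>
    covers all of \<open>E\<close>.\<close>
  have "x \<notin> A"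
  proof
    assume "x \<in> A"
    then have "covers E A B" using AB(3) xyz by (auto simp: covers_def)
    then show False using cover[OF AB(1,2)] AB(4) by simp
  qed
  moreover have "x \<notin> C"
  proof
    assume "x \<in> C"
    then have "covers E C D" using CD(3) xyz by (auto simp: covers_def)
    then show False using cover[OF CD(1,2)] CD(4) by simp
  qed
  ultimately have "z \<in> B" "y \<in> D"
    using AB(3) CD(3) ef xyz by (auto simp: covers_def)
  \<comment> \<open>Uncrossing the two covers: together the new ones are larger than \<open>A, B\<close> and \<open>C, D\<close> by just
    one vertex.\<close>
  then have "covers E (A \<inter> C) (B \<union> D)"
    using AB(3) CD(3) xyz by (fastforce simp: covers_def)
  then have 1: "t \<le> card (A \<inter> C) + card (B \<union> D)"
    using cover AB CD by simp
  have "covers E (insert x (A \<union> C)) (B \<inter> D)"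
    using AB(3) CD(3) xyz by (fastforce simp: covers_def)
  then have "t \<le> card (insert x (A \<union> C)) + card (B \<inter> D)"
    using cover AB CD by simp
  also have "\<dots> \<le> Suc (card (A \<union> C)) + card (B \<inter> D)"
    using AB CD by (simp add: card_insert_if)
  finally have 2: "t \<le> Suc (card (A \<union> C)) + card (B \<inter> D)" .
  show False
    using 1 2 AB CD card_Un_Int[of A C] card_Un_Int[of B D] by simp
qed

text \<open>Edges are deleted as long as every cover still has at least \<open>t\<close> vertices.
  What remains is critical, so the previous lemma, used on the relation and on its converse, makes
  it a matching.\<close>

lemma koenig:
  assumes "finite E"
    and "\<And>A B. finite A \<Longrightarrow> finite B \<Longrightarrow> covers E A B \<Longrightarrow> t \<le> card A + card B"
  shows "\<exists>M\<subseteq>E. inj_on fst M \<and> inj_on snd M \<and> t \<le> card M"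
  using assms
proof (induction E rule: finite_psubset_induct)
  case (psubset E)
  show ?case
  proof (cases "\<exists>e\<in>E. \<forall>A B. finite A \<longrightarrow> finite B \<longrightarrow> covers (E - {e}) A B \<longrightarrow> t \<le> card A + card B")
    case True
    then obtain e where "e \<in> E"
      "\<And>A B. finite A \<Longrightarrow> finite B \<Longrightarrow> covers (E - {e}) A B \<Longrightarrow> t \<le> card A + card B"
      by blast
    then have "\<exists>M\<subseteq>E - {e}. inj_on fst M \<and> inj_on snd M \<and> t \<le> card M"
      using psubset.IH[of "E - {e}"] by blast
    then show ?thesis by blast
  next
    case False
    then have crit: "\<exists>A B. finite A \<and> finite B \<and> covers (E - {e}) A B \<and> card A + card B < t"
      if "e \<in> E" for e
      using that by (meson not_le)
    have inj: "inj_on fst E"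
      using critical_inj_on_fst[OF psubset.prems crit] .
    have "inj_on fst (E\<inverse>)"
    proof (rule critical_inj_on_fst)
      show "t \<le> card A + card B" if "finite A" "finite B" "covers (E\<inverse>) A B" for A B
        using psubset.prems[of B A] that by (simp add: covers_converse add.commute)
      show "\<exists>A B. finite A \<and> finite B \<and> covers (E\<inverse> - {e}) A B \<and> card A + card B < t"
        if e: "e \<in> E\<inverse>" for e
      proof -
        obtain x y where xy: "e = (x, y)" by (cases e)
        then obtain A B where "finite A" "finite B" "covers (E - {(y, x)}) A B" "card A + card B < t"
          using crit[of "(y, x)"] e by auto
        moreover have "E\<inverse> - {e} = (E - {(y, x)})\<inverse>" using xy by auto
        ultimately have "finite B \<and> finite A \<and> covers (E\<inverse> - {e}) B A \<and> card B + card A < t"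
          by (simp add: covers_converse)
        then show ?thesis by blast
      qed
    qed
    then have "inj_on snd E"
      unfolding inj_on_def by (metis converse_iff fst_conv prod.collapse snd_conv)
    \<comment> \<open>The left ends form a cover with exactly one vertex per edge, so there are at
      least \<open>t\<close> edges.\<close>
    moreover have "covers E (fst ` E) {}" by (force simp: covers_def)
    then have "t \<le> card E"
      using psubset.prems[of "fst ` E" "{}"] psubset.hyps card_image[OF inj] by simp
    ultimately show ?thesis using inj by blast
  qed
qed

section \<open>Components and matchings\<close>

lemma finite_Knn_edges: "finite (Knn_edges n)"
proof -
  have "Knn_edges n = (\<lambda>(i, j). {Inl i, Inr j}) ` ({..<n} \<times> {..<n})"
    by (auto simp: Knn_edges_def)
  then show ?thesis by simp
qed

lemma finite_matchings: "finite E \<Longrightarrow> finite {M. is_matching E M}"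
  by (rule finite_subset[of _ "Pow E"]) (auto simp: is_matching_def)

lemma card_le_matching_number:
  "finite E \<Longrightarrow> is_matching E M \<Longrightarrow> card M \<le> matching_number E"
  by (simp add: matching_number_def finite_matchings)

lemma matching_number_attained:
  assumes "finite E"
  obtains M where "is_matching E M" "card M = matching_number E"
proof -
  have "is_matching E {}" by (simp add: is_matching_def)
  then have "matching_number E \<in> card ` {M. is_matching E M}"
    unfolding matching_number_def using finite_matchings[OF assms] by (intro Max_in) auto
  then show ?thesis using that by auto
qed

text \<open>Matching edges are disjoint, so choosing a vertex of \<open>S\<close> in each of them is
  injective.\<close>

lemma matching_number_le_cover:
  assumes "finite E" "finite S" and meets: "\<And>e. e \<in> E \<Longrightarrow> e \<inter> S \<noteq> {}"
  shows "matching_number E \<le> card S"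
proof -
  obtain M where M: "is_matching E M" "card M = matching_number E"
    using matching_number_attained[OF assms(1)] .
  define f where "f e = (SOME v. v \<in> e \<inter> S)" for e
  have f: "f e \<in> e \<inter> S" if "e \<in> M" for e
  proof -
    have "e \<in> E" using that M(1) by (auto simp: is_matching_def)
    from meets[OF this] have "\<exists>v. v \<in> e \<inter> S" by blast
    then show ?thesis unfolding f_def by (rule someI_ex)
  qed
  have "inj_on f M"
  proof (rule inj_onI)
    fix d e assume "d \<in> M" "e \<in> M" "f d = f e"
    then have "d \<inter> e \<noteq> {}" using f[of d] f[of e] by auto
    then show "d = e" using M(1) \<open>d \<in> M\<close> \<open>e \<in> M\<close> unfolding is_matching_def by blast
  qed
  then have "card M \<le> card S"
    using f assms(2) card_inj_on_le[of f M S] by blast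
  then show ?thesis using M by simp
qed

lemma not_connected_matching:
  assumes "finite E" "finite S" "\<And>e. e \<in> E \<Longrightarrow> e \<inter> S \<noteq> {}" "card S < t"
  shows "\<not> connected_matching t V E C"
  using matching_number_le_cover[of "{e \<in> E. e \<subseteq> C}" S] assms
  by (auto simp: connected_matching_def)

text \<open>The colour class as a relation between indices, the form that \<open>koenig\<close>
  takes.\<close>

definition edge_pairs :: "nat \<Rightarrow> ((nat + nat) set \<Rightarrow> colour) \<Rightarrow> colour \<Rightarrow> (nat \<times> nat) set" where
  "edge_pairs n c a = {(i, j). i < n \<and> j < n \<and> c {Inl i, Inr j} = a}"

definition conn :: "nat \<Rightarrow> ((nat + nat) set \<Rightarrow> colour) \<Rightarrow> colour \<Rightarrow> nat + nat \<Rightarrow> nat + nat \<Rightarrow> bool" where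
  "conn n c a u v \<longleftrightarrow> (u, v) \<in> {(x, y). {x, y} \<in> colour_class n c a}\<^sup>*"

lemma conn_refl: "conn n c a u u"
  by (simp add: conn_def)

lemma conn_trans: "conn n c a u v \<Longrightarrow> conn n c a v w \<Longrightarrow> conn n c a u w"
  by (simp add: conn_def)

lemma conn_sym: "conn n c a u v \<Longrightarrow> conn n c a v u"
proof -
  have "sym {(x, y). {x, y} \<in> colour_class n c a}"
    by (auto simp: sym_def insert_commute)
  then show "conn n c a u v \<Longrightarrow> conn n c a v u"
    unfolding conn_def by (meson sym_rtrancl symD)
qed

lemma edge_in_colour_class:
  "(i, j) \<in> edge_pairs n c a \<Longrightarrow> {Inl i, Inr j} \<in> colour_class n c a"
  by (auto simp: edge_pairs_def colour_class_def Knn_edges_def)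

lemma conn_edge: "(i, j) \<in> edge_pairs n c a \<Longrightarrow> conn n c a (Inl i) (Inr j)"
  unfolding conn_def using edge_in_colour_class by (intro r_into_rtrancl) auto

text \<open>Carries a matching from pairs over to a component. Comparing left ends is enough,
  because an edge of \<open>M\<close> joins each right end to its left end.\<close>

lemma connected_matchingI:
  assumes M: "M \<subseteq> edge_pairs n c a" "inj_on fst M" "inj_on snd M"
    and t: "0 < t" "t \<le> card M"
    and con: "\<And>i j i' j'. (i, j) \<in> M \<Longrightarrow> (i', j') \<in> M \<Longrightarrow> conn n c a (Inl i) (Inl i')"
  shows "\<exists>C. connected_matching t (Knn_verts n) (colour_class n c a) C"
proof -
  have "M \<noteq> {}" using t by auto
  then obtain p q where pq: "(p, q) \<in> M" by auto
  define C where "C = {v \<in> Knn_verts n. conn n c a (Inl p) v}"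
  have p: "Inl p \<in> Knn_verts n"
    using pq M(1) by (auto simp: Knn_verts_def edge_pairs_def)
  have "C = {(u, v). u \<in> Knn_verts n \<and> v \<in> Knn_verts n \<and>
      (u, v) \<in> {(x, y). {x, y} \<in> colour_class n c a}\<^sup>*} `` {Inl p}"
    using p by (auto simp: C_def conn_def)
  then have C: "C \<in> components (Knn_verts n) (colour_class n c a)"
    unfolding components_def by (simp only: quotientI[OF p])
  let ?g = "\<lambda>(i, j). {Inl i, Inr j} :: (nat + nat) set"
  have sub: "{Inl i, Inr j} \<subseteq> C" if "(i, j) \<in> M" for i j
  proof -
    have pi: "conn n c a (Inl p) (Inl i)" using con pq that by blast
    have "(i, j) \<in> edge_pairs n c a" using M(1) that by blast
    then have "conn n c a (Inl p) (Inr j)" "i < n" "j < n"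
      using conn_trans[OF pi conn_edge] by (auto simp: edge_pairs_def)
    then show ?thesis
      using pi by (auto simp: C_def Knn_verts_def)
  qed
  have matching: "is_matching {e \<in> colour_class n c a. e \<subseteq> C} (?g ` M)"
    unfolding is_matching_def
  proof (intro conjI ballI impI)
    show "?g ` M \<subseteq> {e \<in> colour_class n c a. e \<subseteq> C}"
    proof (rule image_subsetI)
      fix x assume "x \<in> M"
      then show "?g x \<in> {e \<in> colour_class n c a. e \<subseteq> C}"
        using sub edge_in_colour_class[OF subsetD[OF M(1)]] by (cases x) simp
    qed
  next
    fix e f assume "e \<in> ?g ` M" "f \<in> ?g ` M" "e \<noteq> f"
    then obtain i j i' j' where ij: "(i, j) \<in> M" "e = {Inl i, Inr j}"
      "(i', j') \<in> M" "f = {Inl i', Inr j'}" "(i, j) \<noteq> (i', j')"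
      by blast
    have "i \<noteq> i'" using inj_onD[OF M(2) _ ij(1,3)] ij(5) by auto
    moreover have "j \<noteq> j'" using inj_onD[OF M(3) _ ij(1,3)] ij(5) by auto
    ultimately show "e \<inter> f = {}" using ij by auto
  qed
  have card: "card (?g ` M) = card M"
    by (rule card_image) (auto simp: inj_on_def doubleton_eq_iff)
  have fin: "finite {e \<in> colour_class n c a. e \<subseteq> C}"
    using finite_Knn_edges[of n] by (simp add: colour_class_def)
  have "t \<le> matching_number {e \<in> colour_class n c a. e \<subseteq> C}"
    using card_le_matching_number[OF fin matching] t(2) unfolding card by simp
  then show ?thesis using C by (auto simp: connected_matching_def)
qed

text \<open>A bijection between \<open>t\<close>-subsets of the two sides is a matching, and its
  left ends share the neighbour \<open>b\<close>.\<close>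

lemma connected_matching_complete:
  assumes AB: "A \<times> B \<subseteq> edge_pairs n c a" "t \<le> card A" "t \<le> card B" "0 < t"
  shows "\<exists>C. connected_matching t (Knn_verts n) (colour_class n c a) C"
proof -
  obtain A' where A': "A' \<subseteq> A" "card A' = t" "finite A'"
    using AB(2) obtain_subset_with_card_n by metis
  obtain B' where B': "B' \<subseteq> B" "card B' = t" "finite B'"
    using AB(3) obtain_subset_with_card_n by metis
  obtain h where h: "bij_betw h A' B'"
    using finite_same_card_bij A' B' by metis
  let ?M = "(\<lambda>x. (x, h x)) ` A'"
  have hB: "h x \<in> B'" if "x \<in> A'" for x using h that bij_betwE by blast
  obtain b where b: "b \<in> B" using B' AB(4) by fastforce
  show ?thesis
  proof (rule connected_matchingI)
    show "?M \<subseteq> edge_pairs n c a" using AB(1) A'(1) B'(1) hB by blast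
    show "inj_on fst ?M" by (auto simp: inj_on_def)
    show "inj_on snd ?M" using h by (auto simp: inj_on_def bij_betw_def)
    have "card ?M = t" using A' by (simp add: card_image inj_on_def)
    then show "t \<le> card ?M" by simp
    show "conn n c a (Inl i) (Inl i')" if "(i, j) \<in> ?M" "(i', j') \<in> ?M" for i j i' j'
    proof -
      have "(i, b) \<in> edge_pairs n c a" "(i', b) \<in> edge_pairs n c a"
        using that A'(1) AB(1) b by auto
      then show ?thesis using conn_edge conn_sym conn_trans by meson
    qed
  qed (fact AB(4))
qed

section \<open>The upper bound\<close>

text \<open>Vertices without an edge of the colour may lie elsewhere, and a colour without edges
  qualifies vacuously.\<close>

definition edges_connected :: "nat \<Rightarrow> ((nat + nat) set \<Rightarrow> colour) \<Rightarrow> colour \<Rightarrow> bool" where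
  "edges_connected n c a \<longleftrightarrow>
    (\<forall>(i, j)\<in>edge_pairs n c a. \<forall>(i', j')\<in>edge_pairs n c a. conn n c a (Inl i) (Inl i'))"

text \<open>The colours are variables so that \<open>forces_upper\<close> can use this both ways,
  with the two targets exchanged.\<close>

lemma edges_connected_imp:
  assumes con: "edges_connected n c a" and "a \<noteq> b"
    and ts: "0 < t" "0 < s" "n = t + s - 1"
  shows "(\<exists>C. connected_matching t (Knn_verts n) (colour_class n c a) C) \<or>
    (\<exists>C. connected_matching s (Knn_verts n) (colour_class n c b) C)"
proof (cases "\<exists>A B. finite A \<and> finite B \<and> covers (edge_pairs n c a) A B \<and> card A + card B < t")
  case True
  then obtain A B where AB: "finite A" "finite B" "covers (edge_pairs n c a) A B" "card A + card B < t"
    by blast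
  have other: "x = a \<or> x = b" for x
    using \<open>a \<noteq> b\<close> by (cases x; cases a; cases b) auto
  have "({..<n} - A) \<times> ({..<n} - B) \<subseteq> edge_pairs n c b"
    using AB(3) other by (fastforce simp: covers_def edge_pairs_def)
  moreover have "n - card A \<le> card ({..<n} - A)" "n - card B \<le> card ({..<n} - B)"
    using diff_card_le_card_Diff[OF AB(1), of "{..<n}"] diff_card_le_card_Diff[OF AB(2), of "{..<n}"]
    by auto
  \<comment> \<open>Each of \<open>A\<close> and \<open>B\<close> has at most \<open>t - 1\<close>
    elements, and \<open>n - (t - 1) = s\<close>.\<close>
  then have "s \<le> card ({..<n} - A)" "s \<le> card ({..<n} - B)"
    using AB(4) ts by linarith+
  ultimately show ?thesis
    using connected_matching_complete ts(2) by blast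
next
  case False
  have "edge_pairs n c a \<subseteq> {..<n} \<times> {..<n}" by (auto simp: edge_pairs_def)
  then have "finite (edge_pairs n c a)" by (rule finite_subset) simp
  then obtain M where M: "M \<subseteq> edge_pairs n c a" "inj_on fst M" "inj_on snd M" "t \<le> card M"
    using koenig[of "edge_pairs n c a" t] False by (meson not_le)
  have "\<exists>C. connected_matching t (Knn_verts n) (colour_class n c a) C"
    using con M(1)
    by (intro connected_matchingI[OF M(1-3) ts(1) M(4)]) (fastforce simp: edges_connected_def)
  then show ?thesis ..
qed

lemma not_edges_connected_split:
  assumes red: "\<not> edges_connected n c Red" and blue: "\<not> edges_connected n c Blue"
  obtains X Y where "X \<subseteq> {..<n}" "Y \<subseteq> {..<n}"
    "X \<times> Y \<subseteq> edge_pairs n c Red" "({..<n} - X) \<times> ({..<n} - Y) \<subseteq> edge_pairs n c Red"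
    "X \<times> ({..<n} - Y) \<subseteq> edge_pairs n c Blue" "({..<n} - X) \<times> Y \<subseteq> edge_pairs n c Blue"
proof -
  \<comment> \<open>The second edge lies outside the component of the first, so \<open>X\<close>,
    \<open>Y\<close> and their complements are all nonempty.\<close>
  obtain p q p' q' where pq: "(p, q) \<in> edge_pairs n c Red" "(p', q') \<in> edge_pairs n c Red"
      "\<not> conn n c Red (Inl p) (Inl p')"
    using red by (auto simp: edges_connected_def)
  define X where "X = {x. x < n \<and> conn n c Red (Inl p) (Inl x)}"
  define Y where "Y = {y. y < n \<and> conn n c Red (Inl p) (Inr y)}"
  have pX: "p \<in> X" using pq by (auto simp: X_def edge_pairs_def conn_refl)
  have qY: "q \<in> Y" using pq(1) conn_edge[OF pq(1)] by (auto simp: Y_def edge_pairs_def)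
  have p'X: "p' \<in> {..<n} - X" using pq by (auto simp: X_def edge_pairs_def)
  have q'Y: "q' \<in> {..<n} - Y"
  proof -
    have "\<not> conn n c Red (Inl p) (Inr q')"
      using pq(3) conn_trans conn_sym[OF conn_edge[OF pq(2)]] by metis
    then show ?thesis using pq(2) by (auto simp: Y_def edge_pairs_def)
  qed
  have same: "x \<in> X \<longleftrightarrow> y \<in> Y" if "(x, y) \<in> edge_pairs n c Red" for x y
  proof -
    have "conn n c Red (Inl p) (Inl x) \<longleftrightarrow> conn n c Red (Inl p) (Inr y)"
      using conn_edge[OF that] conn_sym[OF conn_edge[OF that]] conn_trans by metis
    then show ?thesis using that by (auto simp: X_def Y_def edge_pairs_def)
  qed
  have dich: "(x, y) \<in> edge_pairs n c Red \<or> (x, y) \<in> edge_pairs n c Blue" if "x < n" "y < n" for x y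
    using that by (cases "c {Inl x, Inr y}") (auto simp: edge_pairs_def)
  have blue1: "X \<times> ({..<n} - Y) \<subseteq> edge_pairs n c Blue"
    using same dich by (fastforce simp: X_def)
  have blue2: "({..<n} - X) \<times> Y \<subseteq> edge_pairs n c Blue"
    using same dich by (fastforce simp: Y_def)
  let ?b = "conn n c Blue"
  have no_blue: "(x \<in> X) \<noteq> (y \<in> Y)" if xy: "(x, y) \<in> edge_pairs n c Blue" for x y
  proof
    assume eq: "(x \<in> X) = (y \<in> Y)"
    have n: "x < n" "y < n" using xy by (auto simp: edge_pairs_def)
    have 1: "?b (Inl u) (Inr q')" if "u \<in> X" for u
      using blue1 that q'Y by (intro conn_edge) blast
    have 2: "?b (Inl u) (Inr q)" if "u \<in> {..<n} - X" for u
      using blue2 that qY by (intro conn_edge) blast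
    have bxy: "?b (Inl x) (Inr y)" using xy by (rule conn_edge)
    \<comment> \<open>All left vertices in \<open>X\<close> are blue neighbours of
      \<open>q'\<close>, all others of \<open>q\<close>. The path is \<open>q\<close>,
      \<open>p'\<close>, \<open>y\<close>, \<open>x\<close>, \<open>q'\<close> in the first case and
      \<open>q\<close>, \<open>x\<close>, \<open>y\<close>, \<open>p\<close>, \<open>q'\<close> in
      the second.\<close>
    have link: "?b (Inr q) (Inr q')"
    proof (cases "x \<in> X")
      case True
      have "?b (Inl p') (Inr y)" using blue2 p'X eq True by (intro conn_edge) blast
      then have "?b (Inr q) (Inr y)"
        using 2[OF p'X] by (blast intro: conn_trans[OF conn_sym])
      moreover have "?b (Inr y) (Inr q')"
        using 1[OF True] bxy by (blast intro: conn_trans[OF conn_sym])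
      ultimately show ?thesis by (rule conn_trans)
    next
      case False
      then have "x \<in> {..<n} - X" "y \<in> {..<n} - Y" using n eq by auto
      then have xq: "?b (Inl x) (Inr q)" and py: "?b (Inl p) (Inr y)"
        using 2 blue1 pX by (blast intro: conn_edge)+
      from xq bxy have "?b (Inr q) (Inr y)" by (blast intro: conn_trans[OF conn_sym])
      moreover from py 1[OF pX] have "?b (Inr y) (Inr q')" by (blast intro: conn_trans[OF conn_sym])
      ultimately show ?thesis by (rule conn_trans)
    qed
    have all: "?b (Inl u) (Inr q)" if "u < n" for u
      using 1[THEN conn_trans, OF _ conn_sym[OF link]] 2 that by blast
    have "?b (Inl u) (Inl v)" if "u < n" "v < n" for u v
      using conn_trans[OF all conn_sym[OF all]] that .
    then have "edges_connected n c Blue"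
      by (auto simp: edges_connected_def edge_pairs_def)
    then show False using blue by simp
  qed
  show thesis
  proof (rule that[of X Y])
    show "X \<subseteq> {..<n}" "Y \<subseteq> {..<n}" by (auto simp: X_def Y_def)
    show "X \<times> Y \<subseteq> edge_pairs n c Red"
      using no_blue dich by (fastforce simp: X_def Y_def)
    show "({..<n} - X) \<times> ({..<n} - Y) \<subseteq> edge_pairs n c Red"
      using no_blue dich by fastforce
  qed (fact blue1 blue2)+
qed

lemma forces_upper:
  assumes "0 < k" "k \<le> l"
  shows "forces (k + l - 1) k l"
  unfolding forces_def
proof
  fix c
  let ?n = "k + l - 1"
  let ?r = "\<exists>C. connected_matching k (Knn_verts ?n) (colour_class ?n c Red) C"
  let ?b = "\<exists>C. connected_matching l (Knn_verts ?n) (colour_class ?n c Blue) C"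
  show "?r \<or> ?b"
  proof (cases "edges_connected ?n c Red \<or> edges_connected ?n c Blue")
    case True
    then show ?thesis
    proof
      assume "edges_connected ?n c Red"
      from edges_connected_imp[OF this, of Blue k l] show ?thesis using assms by simp
    next
      assume "edges_connected ?n c Blue"
      from edges_connected_imp[OF this, of Red l k] show ?thesis
        using assms by (simp add: add.commute disj_commute)
    qed
  next
    case False
    then obtain X Y where XY: "X \<subseteq> {..<?n}" "Y \<subseteq> {..<?n}"
      "X \<times> Y \<subseteq> edge_pairs ?n c Red" "({..<?n} - X) \<times> ({..<?n} - Y) \<subseteq> edge_pairs ?n c Red"
      "X \<times> ({..<?n} - Y) \<subseteq> edge_pairs ?n c Blue" "({..<?n} - X) \<times> Y \<subseteq> edge_pairs ?n c Blue"
      using not_edges_connected_split by metis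
    have fin: "finite X" "finite Y" using XY(1,2) finite_subset by auto
    have X: "card ({..<?n} - X) = ?n - card X" "card X \<le> ?n"
      using XY(1) fin card_Diff_subset[of X "{..<?n}"] card_mono[of "{..<?n}" X] by auto
    have Y: "card ({..<?n} - Y) = ?n - card Y" "card Y \<le> ?n"
      using XY(2) fin card_Diff_subset[of Y "{..<?n}"] card_mono[of "{..<?n}" Y] by auto
    \<comment> \<open>If \<open>card X < k\<close>, the complement of \<open>X\<close> has at least
      \<open>l\<close> elements, and the second or the fourth case holds according to whether the
      complement of \<open>Y\<close> has \<open>k\<close> elements. If \<open>k \<le> card X\<close>
      and the first case fails, the complement of \<open>Y\<close> has at least \<open>l\<close>
      elements, and the third or the second case holds.\<close>
    consider "k \<le> card X" "k \<le> card Y"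
      | "k \<le> card ({..<?n} - X)" "k \<le> card ({..<?n} - Y)"
      | "l \<le> card X" "l \<le> card ({..<?n} - Y)"
      | "l \<le> card ({..<?n} - X)" "l \<le> card Y"
      using X Y assms by linarith
    then show ?thesis
      using connected_matching_complete[OF XY(3)] connected_matching_complete[OF XY(4)]
        connected_matching_complete[OF XY(5)] connected_matching_complete[OF XY(6)] assms
      by cases auto
  qed
qed

section \<open>The lower bound\<close>

lemma not_forces_lower:
  assumes "0 < k" "0 < l" "n < k + l - 1"
  shows "\<not> forces n k l"
proof -
  define c :: "(nat + nat) set \<Rightarrow> colour"
    where "c e = (if \<exists>i<k - 1. Inl i \<in> e then Red else Blue)" for e
  have fin: "finite (colour_class n c a)" for a
    using finite_Knn_edges[of n] by (simp add: colour_class_def)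
  have "\<not> connected_matching k (Knn_verts n) (colour_class n c Red) C" for C
  proof (rule not_connected_matching[OF fin, of "Inl ` {..<k - 1}"])
    show "e \<inter> Inl ` {..<k - 1} \<noteq> {}" if "e \<in> colour_class n c Red" for e
      using that by (auto simp: colour_class_def c_def split: if_splits)
  qed (use assms in \<open>auto simp: card_image\<close>)
  moreover have "\<not> connected_matching l (Knn_verts n) (colour_class n c Blue) C" for C
  \<comment> \<open>The cover has \<open>n - (k - 1)\<close> elements, hence fewer than
    \<open>l\<close>; for \<open>n < k - 1\<close> it is empty.\<close>
  proof (rule not_connected_matching[OF fin, of "Inl ` {k - 1..<n}"])
    show "e \<inter> Inl ` {k - 1..<n} \<noteq> {}" if e: "e \<in> colour_class n c Blue" for e
    proof -
      obtain i j where ij: "e = {Inl i, Inr j}" "i < n" "c e = Blue"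
        using e by (auto simp: colour_class_def Knn_edges_def)
      then have "\<not> i < k - 1" by (auto simp: c_def)
      then show ?thesis using ij by auto
    qed
  qed (use assms in \<open>auto simp: card_image\<close>)
  ultimately show ?thesis by (auto simp: forces_def)
qed

text \<open>The existence claim ensures that \<open>LEAST\<close> in \<open>r\<close> denotes a true
  minimum.\<close>

theorem theorem3p1:
  fixes k l :: nat
  assumes "2 \<le> k" and "k \<le> l"
  shows "(\<exists>n. forces n k l) \<and> r k l = k + l - 1"
proof -
  have upper: "forces (k + l - 1) k l"
    using assms by (intro forces_upper) auto
  have "k + l - 1 \<le> n" if "forces n k l" for n
    using not_forces_lower[of k l n] that assms by (cases "n < k + l - 1") auto
  then have "r k l = k + l - 1"
    unfolding r_def by (rule Least_equality[where P = "\<lambda>n. forces n k l", OF upper])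
  with upper show ?thesis by blast
qed

end
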